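(* Let $\mathbf{R}$ be a real closed field, $\mathbf{C}=\mathbf{R}(\sqrt{-1})$, and let $(\mathcal{A},* )$ be a $(\mathbf{C},* )$-algebra. Let $n$ be a positive integer and equip $M_n(\mathcal{A})$ with the involution $(a_{ij})^*=(a_{ji}^* )$. Then $(\mathcal{A},* )$ is real reduced if and only if $(M_n(\mathcal{A}),* )$ is real reduced.
   Context: A $*$-ring is an associative unital ring with an involution $*$ satisfying $(a+b)^*=a^*+b^*$, $(ab)^*=b^*a^*$, $(a^* )^*=a$. The field $\mathbf{C}$ carries the conjugation involution over $\mathbf{R}$ ($\sqrt{-1}\mapsto-\sqrt{-1}$). A $(\mathbf{C},* )$-algebra is a $*$-ring $(\mathcal{A},* )$ together with a $*$-homomorphism $\mathbf{C}\to\mathcal{A}$ whose image lies in the center of $\mathcal{A}$. A $*$-ring $(\mathcal{A},* )$ is real reduced if for any finitely many $a_1,\dots,a_k\in\mathcal{A}$, $\sum_i a_i^*a_i=0$ implies $a_i=0$ for all $i$. *)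

theory Defs
  imports "HOL-Analysis.Analysis" "HOL-Computational_Algebra.Polynomial"
begin

section \<open>Real closed fields\<close>

text \<open>A field is real closed iff it is formally real (-1 is not a sum of squares),
  every element is a square or the negative of a square, and every polynomial
  of odd degree has a root (standard equivalent definition, cf. Bochnak-Coste-Roy 1.2.2).\<close>

definition formally_real :: "'r::field itself \<Rightarrow> bool" where
  "formally_real _ \<longleftrightarrow>
     (\<forall>k (x::nat \<Rightarrow> 'r). (\<Sum>i<k. (x i)^2) \<noteq> -1)"

definition real_closed_field :: "'r::field itself \<Rightarrow> bool" where
  "real_closed_field T \<longleftrightarrow>
     formally_real T \<and>
     (\<forall>a::'r. \<exists>b. a = b^2 \<or> a = - (b^2)) \<and>
     (\<forall>p::'r poly. odd (degree p) \<longrightarrow> (\<exists>x. poly p x = 0))"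

section \<open>C = R(sqrt -1), represented as pairs (x,y) meaning x + y sqrt(-1)\<close>

definition cadd :: "'r::field \<times> 'r \<Rightarrow> 'r \<times> 'r \<Rightarrow> 'r \<times> 'r" where
  "cadd z w = (fst z + fst w, snd z + snd w)"

definition cmult :: "'r::field \<times> 'r \<Rightarrow> 'r \<times> 'r \<Rightarrow> 'r \<times> 'r" where
  "cmult z w = (fst z * fst w - snd z * snd w, fst z * snd w + snd z * fst w)"

definition cone :: "'r::field \<times> 'r" where
  "cone = (1, 0)"

definition cconj :: "'r::field \<times> 'r \<Rightarrow> 'r \<times> 'r" where
  "cconj z = (fst z, - snd z)"

section \<open>*-rings, (C,*)-algebras, real reducedness\<close>

definition star_ring :: "('a::ring_1 \<Rightarrow> 'a) \<Rightarrow> bool" where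
  "star_ring st \<longleftrightarrow>
     (\<forall>a b. st (a + b) = st a + st b) \<and>
     (\<forall>a b. st (a * b) = st b * st a) \<and>
     (\<forall>a. st (st a) = a)"

text \<open>A (C,*)-algebra: a *-ring with a unital *-homomorphism from C = R(sqrt -1)
  whose image is central.\<close>

definition C_star_algebra :: "('r::field \<times> 'r \<Rightarrow> 'a::ring_1) \<Rightarrow> ('a \<Rightarrow> 'a) \<Rightarrow> bool" where
  "C_star_algebra \<phi> st \<longleftrightarrow>
     star_ring st \<and>
     (\<forall>z w. \<phi> (cadd z w) = \<phi> z + \<phi> w) \<and>
     (\<forall>z w. \<phi> (cmult z w) = \<phi> z * \<phi> w) \<and>
     \<phi> cone = 1 \<and>
     (\<forall>z. \<phi> (cconj z) = st (\<phi> z)) \<and>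
     (\<forall>z a. \<phi> z * a = a * \<phi> z)"

text \<open>Real reduced, with respect to an explicit multiplication and involution
  (so that it applies both to the ring 'a and to the matrix ring with product **).\<close>

definition real_reduced_wrt :: "('a::comm_monoid_add \<Rightarrow> 'a \<Rightarrow> 'a) \<Rightarrow> ('a \<Rightarrow> 'a) \<Rightarrow> bool" where
  "real_reduced_wrt mul st \<longleftrightarrow>
     (\<forall>k (a::nat \<Rightarrow> 'a). (\<Sum>i<k. mul (st (a i)) (a i)) = 0 \<longrightarrow> (\<forall>i<k. a i = 0))"

text \<open>Involution on M_n(A), n x n matrices indexed by the finite type 'n:
  (a_ij)^* = (a_ji^*).\<close>

definition mat_star :: "('a \<Rightarrow> 'a) \<Rightarrow> 'a ^'n ^'n \<Rightarrow> 'a ^'n ^'n" where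
  "mat_star st M = (\<chi> i j. st (M $ j $ i))"

end

theory Submission
  imports Defs
begin

text \<open>Only the involution matters. The (j, j) entry of \<open>\<Sum>\<^sub>p M\<^sub>p\<^sup>* M\<^sub>p\<close> is
  \<open>\<Sum>\<^sub>p \<Sum>\<^sub>q (M\<^sub>p)\<^sub>q\<^sub>j\<^sup>* (M\<^sub>p)\<^sub>q\<^sub>j\<close>, so real reducedness of the ring kills every entry.
  Conversely, the ring embeds into the matrices as the multiples of one diagonal
  matrix unit, compatibly with \<open>*\<close>.\<close>

lemma star_ring_zero:
  assumes "star_ring st"
  shows "st 0 = 0"
proof -
  have "st (0 + 0) = st 0 + st 0"
    using assms unfolding star_ring_def by blast
  then show ?thesis by simp
qed

lemma real_reduced_wrt_finite_sum:
  assumes rr: "real_reduced_wrt mul st"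
    and "finite S" and sum_eq_0: "(\<Sum>x\<in>S. mul (st (f x)) (f x)) = 0" and "x \<in> S"
  shows "f x = 0"
proof -
  obtain h where h: "bij_betw h {..<card S} S"
    using ex_bij_betw_nat_finite[OF \<open>finite S\<close>] by (auto simp: lessThan_atLeast0)
  have "(\<Sum>i<card S. mul (st ((f \<circ> h) i)) ((f \<circ> h) i)) = 0"
    using sum.reindex_bij_betw[OF h, of "\<lambda>x. mul (st (f x)) (f x)"] sum_eq_0 by simp
  then have "\<forall>i<card S. (f \<circ> h) i = 0"
    using rr unfolding real_reduced_wrt_def by blast
  moreover obtain i where "i < card S" "h i = x"
    using h \<open>x \<in> S\<close> unfolding bij_betw_def by force
  ultimately show ?thesis by auto
qed

lemma mat_star_mult_diagonal:
  "(mat_star st M ** M) $ j $ j = (\<Sum>q\<in>UNIV. st (M $ q $ j) * M $ q $ j)"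
  by (simp add: matrix_matrix_mult_def mat_star_def)

lemma real_reduced_matrix_ring:
  fixes st :: "'a::ring_1 \<Rightarrow> 'a"
  assumes rr: "real_reduced_wrt (*) st"
  shows "real_reduced_wrt ((**) :: 'a ^'n::finite ^'n \<Rightarrow> _) (mat_star st)"
  unfolding real_reduced_wrt_def
proof (intro allI impI)
  fix k and M :: "nat \<Rightarrow> 'a ^'n ^'n" and l
  assume sum_eq_0: "(\<Sum>p<k. mat_star st (M p) ** M p) = 0" and "l < k"
  have "M l $ q $ j = 0" for q j
  proof -
    have "(\<Sum>p<k. \<Sum>q\<in>UNIV. st (M p $ q $ j) * M p $ q $ j) = 0"
      using arg_cong[OF sum_eq_0, of "\<lambda>A. A $ j $ j"]
      by (simp add: sum_component mat_star_mult_diagonal)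
    then have "(\<Sum>x\<in>{..<k} \<times> UNIV. st (M (fst x) $ snd x $ j) * M (fst x) $ snd x $ j) = 0"
      unfolding sum.cartesian_product by (simp only: split_def)
    from real_reduced_wrt_finite_sum[OF rr _ this, of "(l, q)"] \<open>l < k\<close>
    show ?thesis by auto
  qed
  then show "M l = 0" by (simp add: vec_eq_iff)
qed

definition single_entry :: "'n \<Rightarrow> 'a::zero \<Rightarrow> 'a ^'n ^'n" where
  "single_entry j a = (\<chi> r c. if r = j \<and> c = j then a else 0)"

lemma single_entry_eq_0_iff: "single_entry j a = 0 \<longleftrightarrow> a = 0"
  by (auto simp: single_entry_def vec_eq_iff)

lemma sum_single_entry:
  "(\<Sum>p\<in>A. single_entry j (f p)) = single_entry j (\<Sum>p\<in>A. f p)"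
  by (simp add: single_entry_def vec_eq_iff sum_component if_distrib sum.If_cases
      cong: if_cong)

lemma mat_star_single_entry_mult:
  fixes a b :: "'a::ring_1" and j :: "'n::finite"
  assumes "st 0 = 0"
  shows "mat_star st (single_entry j a) ** single_entry j b = single_entry j (st a * b)"
proof -
  have "(\<Sum>q\<in>UNIV. st (single_entry j a $ q $ r) * single_entry j b $ q $ c)
        = (if r = j \<and> c = j then st a * b else 0)" for r c
  proof -
    have "(\<Sum>q\<in>UNIV. st (single_entry j a $ q $ r) * single_entry j b $ q $ c)
          = (\<Sum>q\<in>UNIV. if q = j then (if r = j \<and> c = j then st a * b else 0) else 0)"
      by (rule sum.cong) (auto simp: single_entry_def assms)
    then show ?thesis by simp
  qed
  then show ?thesis
    by (simp add: vec_eq_iff matrix_matrix_mult_def mat_star_def single_entry_def)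
qed

lemma real_reduced_of_matrix_ring:
  fixes st :: "'a::ring_1 \<Rightarrow> 'a"
  assumes "st 0 = 0"
    and rr: "real_reduced_wrt ((**) :: 'a ^'n::finite ^'n \<Rightarrow> _) (mat_star st)"
  shows "real_reduced_wrt (*) st"
  unfolding real_reduced_wrt_def
proof (intro allI impI)
  fix k and a :: "nat \<Rightarrow> 'a" and l
  assume sum_eq_0: "(\<Sum>i<k. st (a i) * a i) = 0" and "l < k"
  fix j :: 'n
  define E where "E p = single_entry j (a p)" for p
  have "(\<Sum>p<k. mat_star st (E p) ** E p) = 0"
    using sum_eq_0 \<open>st 0 = 0\<close>
    by (simp add: E_def mat_star_single_entry_mult sum_single_entry single_entry_eq_0_iff)
  then have "E l = 0"
    using rr \<open>l < k\<close> unfolding real_reduced_wrt_def by blast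
  then show "a l = 0" by (simp add: E_def single_entry_eq_0_iff)
qed

theorem lemma7:
  fixes \<phi> :: "'r::field \<times> 'r \<Rightarrow> 'a::ring_1"
    and st :: "'a \<Rightarrow> 'a"
  assumes "real_closed_field TYPE('r)"
    and "C_star_algebra \<phi> st"
  shows "real_reduced_wrt ((*) :: 'a \<Rightarrow> 'a \<Rightarrow> 'a) st \<longleftrightarrow>
         real_reduced_wrt ((**) :: 'a ^'n::finite ^'n \<Rightarrow> 'a ^'n ^'n \<Rightarrow> 'a ^'n ^'n) (mat_star st)"
proof -
  have "st 0 = 0"
    using assms(2) star_ring_zero unfolding C_star_algebra_def by blast
  then show ?thesis
    using real_reduced_matrix_ring real_reduced_of_matrix_ring by blast
qed

end
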